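(* Let $w:\mathbb{R}^n\to\mathbb{R}^n$ and consider the perturbed system $z_{k+1}=\bar w(z_k,q_k)=w(z_k)+q_k$, $k\in\mathbb{N}$, with equilibrium $z^e\in\mathbb{R}^n$ when $q_k=0$ for all $k\in\mathbb{N}$ (i.e. $w(z^e)=z^e$). Suppose there exist a locally Lipschitz function $V:\mathbb{R}^n\to\mathbb{R}_{\ge0}$, class-$\mathcal{K}_\infty$ functions $\alpha_1,\alpha_2,\alpha_3$, and a constant $R>0$ such that $$\alpha_1(\|z-z^e\|)\le V(z)\le\alpha_2(\|z-z^e\|)\qquad\forall z\in\mathcal{B}_R(z^e),$$ $$V(\bar w(z,0))-V(z)\le-\alpha_3(\|z-z^e\|)\qquad\forall z\in\mathcal{B}_R(z^e).$$ Then there exist a class-$\mathcal{KL}$ function $\beta$, a class-$\mathcal{K}$ function $\gamma$, and radii $\bar r,\bar q>0$ such that, for every perturbation sequence with $\sup_k\|q_k\|\le\bar q$ and every $z_0\in\mathcal{B}_{\bar r}(z^e)$, the solution of $z_{k+1}=w(z_k)+q_k$ satisfies $$\|z_k-z^e\|\le\beta(\|z_0-z^e\|,k)+\gamma\Bigl(\sup_{0\le j\le k}\|q_j\|\Bigr),\qquad k\ge0.$$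
   Context: $\mathbb{N}$ includes $0$; $\|\cdot\|$ is the Euclidean norm; $\mathcal{B}_\delta(z^* )=\{z\in\mathbb{R}^n:\|z-z^*\|\le\delta\}$. A continuous function $\alpha:[0,a)\to[0,\infty)$ ($a>0$ or $a=\infty$) is of class $\mathcal{K}$ if it is strictly increasing and $\alpha(0)=0$; it is of class $\mathcal{K}_\infty$ if in addition $a=\infty$ and $\alpha(s)\to\infty$ as $s\to\infty$. A continuous $\beta:[0,\infty)\times[0,\infty)\to[0,\infty)$ is of class $\mathcal{KL}$ if $\beta(\cdot,t)\in\mathcal{K}$ for each fixed $t\ge0$ and, for each fixed $s\ge0$, $\beta(s,\cdot)$ is decreasing (not necessarily strictly) with $\beta(s,t)\to0$ as $t\to\infty$.
   Formalization: The formal theorem additionally assumes that w is continuous at the equilibrium z^e; without this the claim is false (w may jump out of B_R where V is not bounded below), and the conclusion itself forces this continuity. *)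

theory Defs
  imports "HOL-Analysis.Analysis"
begin

text \<open>
  Comparison functions are total HOL functions of which only the values on the stated domain
  matter; the domain of a class K function is \<open>[0, a)\<close> with \<open>a\<close> positive, possibly infinite.
\<close>

definition class_K :: "ereal \<Rightarrow> (real \<Rightarrow> real) \<Rightarrow> bool" where
  "class_K a \<alpha> \<longleftrightarrow> 0 < a \<and>
     continuous_on {s. 0 \<le> s \<and> ereal s < a} \<alpha> \<and>
     \<alpha> ` {s. 0 \<le> s \<and> ereal s < a} \<subseteq> {0..} \<and>
     strict_mono_on {s. 0 \<le> s \<and> ereal s < a} \<alpha> \<and>
     \<alpha> 0 = 0"

definition class_K_inf :: "(real \<Rightarrow> real) \<Rightarrow> bool" where
  "class_K_inf \<alpha> \<longleftrightarrow> class_K \<infinity> \<alpha> \<and> filterlim \<alpha> at_top at_top"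

definition class_KL :: "(real \<Rightarrow> real \<Rightarrow> real) \<Rightarrow> bool" where
  "class_KL \<beta> \<longleftrightarrow>
     continuous_on ({0..} \<times> {0..}) (\<lambda>(s, t). \<beta> s t) \<and>
     (\<forall>s\<ge>0. \<forall>t\<ge>0. 0 \<le> \<beta> s t) \<and>
     (\<forall>t\<ge>0. class_K \<infinity> (\<lambda>s. \<beta> s t)) \<and>
     (\<forall>s\<ge>0. antimono_on {0..} (\<beta> s) \<and> (\<beta> s \<longlongrightarrow> 0) at_top)"

text \<open>
  The library notion \<^const>\<open>local_lipschitz\<close> is for families of functions; here it is
  used for the constant family.
\<close>

definition locally_lipschitz :: "('a::metric_space \<Rightarrow> 'b::metric_space) \<Rightarrow> bool" where
  "locally_lipschitz f \<longleftrightarrow> local_lipschitz (UNIV :: real set) UNIV (\<lambda>_. f)"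

definition perturbed :: "('a::real_vector \<Rightarrow> 'a) \<Rightarrow> 'a \<Rightarrow> 'a \<Rightarrow> 'a" where
  "perturbed w z q = w z + q"

definition is_solution ::
    "('a::real_vector \<Rightarrow> 'a) \<Rightarrow> (nat \<Rightarrow> 'a) \<Rightarrow> (nat \<Rightarrow> 'a) \<Rightarrow> bool" where
  "is_solution w q z \<longleftrightarrow> (\<forall>k. z (Suc k) = perturbed w (z k) (q k))"

end

theory Submission
  imports Defs
begin

text \<open>
  Along a solution, write \<open>x\<^sub>k\<close> for the distance to the equilibrium and \<open>v\<^sub>k\<close> for the value of the
  Lyapunov function. If \<open>V\<close> is Lipschitz with constant \<open>L\<close> on the ball where the hypotheses hold, a
  perturbation of size at most \<open>u\<close> costs at most \<open>d = L u\<close>: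
  \<open>v\<^sub>k\<^sub>+\<^sub>1 \<le> v\<^sub>k - \<alpha>3 x\<^sub>k + d\<close>. Each step then falls under one of two cases
  (\<open>decrease_or_bounded\<close>). Either \<open>2 d \<le> \<alpha>3 x\<^sub>k\<close>, and at least half of the decrease survives, or
  \<open>x\<^sub>k\<close> is so small that \<open>v\<^sub>k\<^sub>+\<^sub>1\<close> is at most \<open>\<alpha>2 (\<alpha>3\<^sup>-\<^sup>1 (2 d)) + d\<close>. Once the second case has
  occurred, that bound persists for good, and \<open>\<gamma> u\<close> is its image under \<open>\<alpha>1\<^sup>-\<^sup>1\<close>.

  As long as only the first case has occurred, \<open>v\<close> has been decreasing, so all earlier decrements
  are at least \<open>\<psi> x\<^sub>k\<close> for \<open>\<psi> = (\<alpha>3 \<circ> \<alpha>2\<^sup>-\<^sup>1 \<circ> \<alpha>1) / 2\<close>. Summing them gives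
  \<open>\<alpha>1 x\<^sub>k + k \<psi> x\<^sub>k \<le> \<alpha>2 x\<^sub>0\<close> (\<open>transient_or_bounded\<close>). The left side is strictly increasing in
  \<open>x\<^sub>k\<close>, so \<open>x\<^sub>k \<le> \<beta> x\<^sub>0 k\<close> where \<open>\<beta> s t\<close> is the root \<open>x\<close> of \<open>\<alpha>1 x + t \<psi> x = \<alpha>2 s\<close>. This
  implicit definition makes sense for real \<open>t\<close> at once, and it makes \<open>\<beta>\<close> class KL
  (\<open>class_KL_implicit_root\<close>), so the discrete-time bound needs no interpolation.

  What remains is to stay in the ball. Continuity of \<open>w\<close> at the equilibrium yields a smaller ball
  that \<open>w\<close> maps well inside the large one, and the sublevel bound \<open>v\<^sub>k \<le> \<alpha>1 \<delta>\<close> is invariant by the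
  same case distinction as soon as the perturbations are small.
\<close>

section \<open>Comparison functions\<close>

lemma class_K_infinity_iff:
  "class_K \<infinity> \<alpha> \<longleftrightarrow> continuous_on {0..} \<alpha> \<and> strict_mono_on {0..} \<alpha> \<and> \<alpha> 0 = 0"
proof -
  have dom: "{s::real. 0 \<le> s \<and> ereal s < \<infinity>} = {0..}" by auto
  have "\<alpha> s \<ge> 0" if "strict_mono_on {0..} \<alpha>" "\<alpha> 0 = 0" "s \<ge> 0" for s
    using strict_mono_on_leD[OF that(1), of 0 s] that by auto
  then show ?thesis unfolding class_K_def dom by auto
qed

lemma class_K_zero: "class_K \<infinity> \<alpha> \<Longrightarrow> \<alpha> 0 = 0"
  by (simp add: class_K_infinity_iff)

lemma class_K_le_iff:
  assumes "class_K \<infinity> \<alpha>" "0 \<le> x" "0 \<le> y"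
  shows "\<alpha> x \<le> \<alpha> y \<longleftrightarrow> x \<le> y"
  using assms strict_mono_on_less_eq[of "{0..}" \<alpha> x y] by (simp add: class_K_infinity_iff)

lemma class_K_less_iff:
  assumes "class_K \<infinity> \<alpha>" "0 \<le> x" "0 \<le> y"
  shows "\<alpha> x < \<alpha> y \<longleftrightarrow> x < y"
  using assms strict_mono_on_less[of "{0..}" \<alpha> x y] by (simp add: class_K_infinity_iff)

lemma class_K_nonneg: "class_K \<infinity> \<alpha> \<Longrightarrow> 0 \<le> x \<Longrightarrow> 0 \<le> \<alpha> x"
  using class_K_le_iff[of \<alpha> 0 x] by (simp add: class_K_zero)

lemma class_K_pos: "class_K \<infinity> \<alpha> \<Longrightarrow> 0 < x \<Longrightarrow> 0 < \<alpha> x"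
  using class_K_less_iff[of \<alpha> 0 x] by (simp add: class_K_zero)

lemma class_K_cont: "class_K \<infinity> \<alpha> \<Longrightarrow> continuous_on {0..} \<alpha>"
  by (simp add: class_K_infinity_iff)

lemma class_K_id: "class_K \<infinity> (\<lambda>x. x)"
  by (simp add: class_K_infinity_iff strict_mono_on_def)

lemma class_K_comp:
  assumes "class_K \<infinity> f" "class_K \<infinity> g"
  shows "class_K \<infinity> (\<lambda>x. f (g x))"
proof -
  have "continuous_on {0..} (\<lambda>x. f (g x))"
    by (rule continuous_on_compose2[OF class_K_cont[OF assms(1)] class_K_cont[OF assms(2)]])
      (use class_K_nonneg[OF assms(2)] in auto)
  moreover have "strict_mono_on {0..} (\<lambda>x. f (g x))"
    using assms by (auto simp: strict_mono_on_def class_K_less_iff class_K_nonneg)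
  ultimately show ?thesis
    using assms by (simp add: class_K_infinity_iff class_K_zero)
qed

lemma class_K_add:
  assumes "class_K \<infinity> f" "class_K \<infinity> g"
  shows "class_K \<infinity> (\<lambda>x. f x + g x)"
  using assms by (auto simp: class_K_infinity_iff strict_mono_on_def
      intro!: continuous_intros add_strict_mono)

lemma class_K_scale:
  assumes "class_K \<infinity> f" "0 < c"
  shows "class_K \<infinity> (\<lambda>x. c * f x)"
  using assms by (auto simp: class_K_infinity_iff strict_mono_on_def intro!: continuous_intros)

section \<open>Implicitly defined class KL functions\<close>

text \<open>
  The root moves up with \<open>s\<close> and down with \<open>t\<close> because the left side is increasing in both the
  unknown and \<open>t\<close>; it tends to zero because a root staying above \<open>y > 0\<close> would force
  \<open>t * b y \<le> c s\<close> for all \<open>t\<close>. Joint continuity needs no estimate: comparing the root with a fixed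
  \<open>y\<close> amounts to comparing \<open>a y + t * b y\<close> with \<open>c s\<close>, which is an open condition on \<open>(s, t)\<close>.
\<close>

lemma class_KL_implicit_root:
  assumes a: "class_K_inf a" and b: "class_K \<infinity> b" and c: "class_K \<infinity> c"
  obtains \<beta> where "class_KL \<beta>"
    and "\<And>s t. 0 \<le> s \<Longrightarrow> 0 \<le> t \<Longrightarrow> 0 \<le> \<beta> s t"
    and "\<And>s t. 0 \<le> s \<Longrightarrow> 0 \<le> t \<Longrightarrow> a (\<beta> s t) + t * b (\<beta> s t) = c s"
    and "\<And>s t x. 0 \<le> s \<Longrightarrow> 0 \<le> t \<Longrightarrow> 0 \<le> x \<Longrightarrow> a x + t * b x \<le> c s \<Longrightarrow> x \<le> \<beta> s t"
proof -
  have aK: "class_K \<infinity> a" using a by (simp add: class_K_inf_def)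
  define F where "F t x = a x + t * b x" for t x
  have Fmono: "F t x < F t y" if "0 \<le> t" "0 \<le> x" "x < y" for t x y
    using that class_K_less_iff[OF aK, of x y] class_K_le_iff[OF b, of x y]
    by (auto simp: F_def intro!: add_less_le_mono mult_left_mono)
  have Fless: "F t x < F t y \<longleftrightarrow> x < y" if "0 \<le> t" "0 \<le> x" "0 \<le> y" for t x y
    using Fmono[of t x y] Fmono[of t y x] that by (cases x y rule: linorder_cases) auto
  have ex: "\<exists>x\<ge>0. F t x = c s" if "0 \<le> s" "0 \<le> t" for s t
  proof -
    have "filterlim a at_top at_top" using a by (simp add: class_K_inf_def)
    then have "eventually (\<lambda>x. c s \<le> a x) at_top"
      by (simp add: filterlim_at_top)
    then obtain N where N: "\<And>x. x \<ge> N \<Longrightarrow> c s \<le> a x"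
      by (auto simp: eventually_at_top_linorder)
    define y where "y = max 0 N"
    have "0 \<le> y" "c s \<le> F t y"
      using N[of y] class_K_nonneg[OF b, of y] that by (auto simp: y_def F_def intro: add_increasing2)
    moreover have "F t 0 \<le> c s"
      using that class_K_nonneg[OF c] by (simp add: F_def class_K_zero aK b)
    moreover have "continuous_on {0..y} (F t)"
      unfolding F_def by (intro continuous_intros continuous_on_subset[OF class_K_cont[OF aK]]
          continuous_on_subset[OF class_K_cont[OF b]]) auto
    ultimately show ?thesis using IVT'[of "F t" 0 "c s" y] by auto
  qed
  define \<beta> where "\<beta> s t = (SOME x. 0 \<le> x \<and> F t x = c s)" for s t
  have \<beta>: "0 \<le> \<beta> s t" "F t (\<beta> s t) = c s" if "0 \<le> s" "0 \<le> t" for s t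
    using someI_ex[of "\<lambda>x. 0 \<le> x \<and> F t x = c s"] ex[OF that] by (auto simp: \<beta>_def)
  have less: "y < \<beta> s t \<longleftrightarrow> F t y < c s" if "0 \<le> s" "0 \<le> t" "0 \<le> y" for s t y
    using Fless[of t y "\<beta> s t"] \<beta> that by simp
  have gr: "\<beta> s t < y \<longleftrightarrow> c s < F t y" if "0 \<le> s" "0 \<le> t" "0 \<le> y" for s t y
    using Fless[of t "\<beta> s t" y] \<beta> that by simp
  let ?Q = "{0..} \<times> {0..} :: (real \<times> real) set"
  have cont: "continuous_on ?Q (\<lambda>(s, t). \<beta> s t)"
    unfolding continuous_on_def
  proof (intro ballI)
    fix p :: "real \<times> real" assume p: "p \<in> ?Q"
    have inQ: "eventually (\<lambda>q. q \<in> ?Q) (at p within ?Q)"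
      by (auto simp: eventually_at_filter)
    have "continuous_on ?Q (\<lambda>q. c (fst q))"
      by (rule continuous_on_compose2[OF class_K_cont[OF c]]) (auto intro!: continuous_intros)
    then have c_lim: "((\<lambda>q. c (fst q)) \<longlongrightarrow> c (fst p)) (at p within ?Q)"
      using p unfolding continuous_on_def by blast
    have F_lim: "((\<lambda>q. F (snd q) y) \<longlongrightarrow> F (snd p) y) (at p within ?Q)" for y
      unfolding F_def by (intro tendsto_intros)
    show "((\<lambda>(s, t). \<beta> s t) \<longlongrightarrow> (case p of (s, t) \<Rightarrow> \<beta> s t)) (at p within ?Q)"
    proof (rule order_tendstoI)
      fix y assume y: "y < (case p of (s, t) \<Rightarrow> \<beta> s t)"
      show "eventually (\<lambda>q. y < (case q of (s, t) \<Rightarrow> \<beta> s t)) (at p within ?Q)"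
      proof (cases "y < 0")
        case True
        show ?thesis using inQ
          by eventually_elim (use True \<beta>(1) in \<open>auto intro: less_le_trans\<close>)
      next
        case False
        then have "0 < c (fst p) - F (snd p) y" using y p less by auto
        then have "eventually (\<lambda>q. 0 < c (fst q) - F (snd q) y) (at p within ?Q)"
          using order_tendstoD(1)[OF tendsto_diff[OF c_lim F_lim]] by blast
        then show ?thesis using inQ
          by eventually_elim (use False less in auto)
      qed
    next
      fix y assume y: "(case p of (s, t) \<Rightarrow> \<beta> s t) < y"
      with p \<beta>(1) have y0: "0 \<le> y" by (force intro: less_imp_le)
      have "c (fst p) - F (snd p) y < 0" using y0 y p gr by auto
      then have "eventually (\<lambda>q. c (fst q) - F (snd q) y < 0) (at p within ?Q)"
        using order_tendstoD(2)[OF tendsto_diff[OF c_lim F_lim]] by blast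
      then show "eventually (\<lambda>q. (case q of (s, t) \<Rightarrow> \<beta> s t) < y) (at p within ?Q)" using inQ
        by eventually_elim (use y0 gr in auto)
    qed
  qed
  have K: "class_K \<infinity> (\<lambda>s. \<beta> s t)" if t: "0 \<le> t" for t
    unfolding class_K_infinity_iff
  proof (intro conjI)
    have "continuous_on {0..} (\<lambda>s. (\<lambda>(s, t). \<beta> s t) (s, t))"
      by (rule continuous_on_compose2[OF cont]) (use t in \<open>auto intro!: continuous_intros\<close>)
    then show "continuous_on {0..} (\<lambda>s. \<beta> s t)" by simp
    show "strict_mono_on {0..} (\<lambda>s. \<beta> s t)"
      using less \<beta> class_K_less_iff[OF c] t by (auto simp: strict_mono_on_def)
    have "\<not> 0 < \<beta> 0 t"
      using less[of 0 t 0] t by (simp add: F_def class_K_zero aK b c)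
    then show "\<beta> 0 t = 0" using \<beta>(1)[of 0 t] t by simp
  qed
  have anti: "antimono_on {0..} (\<beta> s)" if s: "0 \<le> s" for s
  proof (rule monotone_onI)
    fix t t' :: real assume t: "t \<in> {0..}" "t' \<in> {0..}" "t \<le> t'"
    have "F t (\<beta> s t') \<le> F t' (\<beta> s t')"
      using t \<beta>(1)[of s t'] s class_K_nonneg[OF b] by (auto simp: F_def intro!: mult_right_mono)
    also have "\<dots> = c s" using \<beta> s t by auto
    finally show "\<beta> s t \<ge> \<beta> s t'" using gr[of s t "\<beta> s t'"] s t \<beta>(1) by auto
  qed
  have lim: "(\<beta> s \<longlongrightarrow> 0) at_top" if s: "0 \<le> s" for s
  proof (rule order_tendstoI)
    fix y :: real assume "y < 0"
    then show "eventually (\<lambda>t. y < \<beta> s t) at_top"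
      using \<beta>(1)[OF s] by (intro eventually_at_top_linorderI[of 0]) (auto intro: less_le_trans)
  next
    fix y :: real assume y: "0 < y"
    have by_pos: "0 < b y" "0 < a y" using y class_K_pos b aK by auto
    show "eventually (\<lambda>t. \<beta> s t < y) at_top"
    proof (rule eventually_at_top_linorderI)
      fix t assume t: "c s / b y \<le> t"
      have "0 \<le> c s / b y" using by_pos class_K_nonneg[OF c s] by simp
      with t have t0: "0 \<le> t" by simp
      have "c s \<le> t * b y" using t by_pos by (simp add: pos_divide_le_eq)
      then have "c s < F t y" using by_pos by (simp add: F_def)
      then show "\<beta> s t < y" using gr[of s t y] s t0 y by simp
    qed
  qed
  show ?thesis
  proof (rule that)
    show "class_KL \<beta>"
      unfolding class_KL_def using cont \<beta>(1) K anti lim by auto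
    show "0 \<le> \<beta> s t" "a (\<beta> s t) + t * b (\<beta> s t) = c s" if "0 \<le> s" "0 \<le> t" for s t
      using \<beta>[OF that] by (auto simp: F_def)
    show "x \<le> \<beta> s t" if "0 \<le> s" "0 \<le> t" "0 \<le> x" "a x + t * b x \<le> c s" for s t x
      using gr[of s t x] that by (auto simp: F_def)
  qed
qed

text \<open>An inverse is the section at \<open>t = 0\<close> of a root of the preceding kind.\<close>

lemma class_K_inf_inverse:
  assumes "class_K_inf a"
  obtains a' where "class_K \<infinity> a'" and "\<And>s. 0 \<le> s \<Longrightarrow> 0 \<le> a' s" and "\<And>s. 0 \<le> s \<Longrightarrow> a (a' s) = s"
proof -
  obtain \<beta> where \<beta>: "class_KL \<beta>" "\<And>s t. 0 \<le> s \<Longrightarrow> 0 \<le> t \<Longrightarrow> 0 \<le> \<beta> s t"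
    "\<And>s t. 0 \<le> s \<Longrightarrow> 0 \<le> t \<Longrightarrow> a (\<beta> s t) + t * \<beta> s t = s"
    using class_KL_implicit_root[OF assms class_K_id class_K_id] by metis
  show ?thesis
    by (rule that[of "\<lambda>s. \<beta> s 0"])
      (use \<beta>(1,2) \<beta>(3)[of _ 0] in \<open>auto simp: class_KL_def\<close>)
qed

section \<open>The scalar dissipation inequality\<close>

lemma decrease_or_bounded:
  assumes a2: "class_K \<infinity> a2" and a3: "class_K \<infinity> a3"
    and inv: "\<And>s. 0 \<le> s \<Longrightarrow> 0 \<le> a3' s" "\<And>s. 0 \<le> s \<Longrightarrow> a3 (a3' s) = s"
    and "0 \<le> x" "0 \<le> d" "v \<le> a2 x" and step: "v' \<le> v - a3 x + d"
  shows "(2 * d \<le> a3 x \<and> v' \<le> v - a3 x / 2) \<or> v' \<le> a2 (a3' (2 * d)) + d"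
proof (cases "2 * d \<le> a3 x")
  case True
  then show ?thesis using step by simp
next
  case False
  then have "a3 x \<le> a3 (a3' (2 * d))" using inv \<open>0 \<le> d\<close> by simp
  then have "x \<le> a3' (2 * d)"
    using class_K_le_iff[OF a3, of x "a3' (2 * d)"] inv \<open>0 \<le> x\<close> \<open>0 \<le> d\<close> by simp
  then have "a2 x \<le> a2 (a3' (2 * d))" 
    using class_K_le_iff[OF a2] inv \<open>0 \<le> x\<close> \<open>0 \<le> d\<close> by simp
  then show ?thesis using step class_K_nonneg[OF a3 \<open>0 \<le> x\<close>] \<open>v \<le> a2 x\<close> by linarith
qed

text \<open>
  While the decrease dominates, \<open>v\<close> is decreasing, so each earlier state satisfies
  \<open>a1 (x k) \<le> v k \<le> v j \<le> a2 (x j)\<close>. Hence the decrement at time \<open>j\<close>, a function of \<open>x j\<close>, is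
  bounded below in terms of the final \<open>x k\<close> alone, and \<open>k\<close> such decrements fit into \<open>v 0\<close>.
\<close>

lemma transient_or_bounded:
  fixes x v :: "nat \<Rightarrow> real"
  assumes a1: "class_K \<infinity> a1" and a2: "class_K \<infinity> a2" and a3: "class_K \<infinity> a3"
    and inv2: "\<And>s. 0 \<le> s \<Longrightarrow> 0 \<le> a2' s" "\<And>s. 0 \<le> s \<Longrightarrow> a2 (a2' s) = s"
    and inv3: "\<And>s. 0 \<le> s \<Longrightarrow> 0 \<le> a3' s" "\<And>s. 0 \<le> s \<Longrightarrow> a3 (a3' s) = s"
    and x: "\<And>j. 0 \<le> x j" and "0 \<le> d"
    and low: "\<And>j. a1 (x j) \<le> v j" and upp: "\<And>j. v j \<le> a2 (x j)"
    and step: "\<And>j. j < k \<Longrightarrow> v (Suc j) \<le> v j - a3 (x j) + d"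
  shows "a1 (x k) + real k * (a3 (a2' (a1 (x k))) / 2) \<le> a2 (x 0)
    \<or> a1 (x k) \<le> a2 (a3' (2 * d)) + d"
proof -
  let ?B = "a2 (a3' (2 * d)) + d"
  have half: "(2 * d \<le> a3 (x j) \<and> v (Suc j) \<le> v j - a3 (x j) / 2) \<or> v (Suc j) \<le> ?B"
    if "j < k" for j
    using decrease_or_bounded[OF a2 a3 inv3 x \<open>0 \<le> d\<close> upp step[OF that]] by blast
  have a3x: "0 \<le> a3 (x j)" for j using class_K_nonneg[OF a3 x] .
  have "(\<forall>i<j. v (Suc i) \<le> v i - a3 (x i) / 2) \<or> v j \<le> ?B" if "j \<le> k" for j
    using that
  proof (induction j)
    case (Suc j)
    then show ?case using half[of j] a3x[of j] less_Suc_eq by fastforce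
  qed simp
  then consider "\<forall>i<k. v (Suc i) \<le> v i - a3 (x i) / 2" | "v k \<le> ?B" by blast
  then show ?thesis
  proof cases
    case 1
    have vk: "v k \<le> v j" if "j \<le> k" for j
      using that
    proof (induction j rule: inc_induct)
      case (step j)
      then show ?case using 1 a3x[of j] by fastforce
    qed simp
    define y where "y = a2' (a1 (x k))"
    have y: "0 \<le> y" "a2 y = a1 (x k)"
      using inv2 class_K_nonneg[OF a1 x] by (auto simp: y_def)
    have dec: "a3 y \<le> a3 (x j)" if "j \<le> k" for j
    proof -
      have "a2 y \<le> a2 (x j)" using y low[of k] vk[OF that] upp[of j] by linarith
      then show ?thesis
        using class_K_le_iff[OF a2 y(1) x] class_K_le_iff[OF a3 y(1) x] by simp
    qed
    have "v j + real j * (a3 y / 2) \<le> v 0" if "j \<le> k" for j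
      using that
    proof (induction j)
      case (Suc j)
      then have "v (Suc j) \<le> v j - a3 (x j) / 2" "a3 y \<le> a3 (x j)" using 1 dec[of j] by auto
      then show ?case using Suc by (simp add: algebra_simps add_divide_distrib)
    qed simp
    from this[of k] low[of k] upp[of 0] show ?thesis by (simp add: y_def)
  next
    case 2
    then show ?thesis using low[of k] by simp
  qed
qed

section \<open>Local input-to-state stability\<close>

theorem theorem2:
  fixes w :: "real ^ 'n \<Rightarrow> real ^ 'n"
    and ze :: "real ^ 'n"
    and V :: "real ^ 'n \<Rightarrow> real"
    and \<alpha>1 \<alpha>2 \<alpha>3 :: "real \<Rightarrow> real"
    and R :: real
  assumes equilibrium: "perturbed w ze 0 = ze"
    and w_cont: "isCont w ze"
    and V_nonneg: "\<And>z. 0 \<le> V z"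
    and V_lipschitz: "locally_lipschitz V"
    and "class_K_inf \<alpha>1" and "class_K_inf \<alpha>2" and "class_K_inf \<alpha>3"
    and "0 < R"
    and V_bounds: "\<forall>z\<in>cball ze R. \<alpha>1 (norm (z - ze)) \<le> V z \<and> V z \<le> \<alpha>2 (norm (z - ze))"
    and V_decrease: "\<forall>z\<in>cball ze R. V (perturbed w z 0) - V z \<le> - \<alpha>3 (norm (z - ze))"
  shows "\<exists>\<beta> \<gamma> a rbar qbar.
    class_KL \<beta> \<and> class_K a \<gamma> \<and> 0 < rbar \<and> 0 < qbar \<and> ereal qbar < a \<and>
    (\<forall>q z. (SUP k. ereal (norm (q k))) \<le> ereal qbar \<and> z 0 \<in> cball ze rbar \<and>
           is_solution w q z \<longrightarrow>
       (\<forall>k. norm (z k - ze) \<le> \<beta> (norm (z 0 - ze)) (real k) + \<gamma> (SUP j\<in>{0..k}. norm (q j))))"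
proof -
  have a1: "class_K_inf \<alpha>1" and a2: "class_K_inf \<alpha>2" and a3: "class_K_inf \<alpha>3" using assms(5-7) .
  have K: "class_K \<infinity> \<alpha>1" "class_K \<infinity> \<alpha>2" "class_K \<infinity> \<alpha>3"
    using a1 a2 a3 by (auto simp: class_K_inf_def)
  obtain i1 where i1: "class_K \<infinity> i1" "\<And>s. 0 \<le> s \<Longrightarrow> 0 \<le> i1 s" "\<And>s. 0 \<le> s \<Longrightarrow> \<alpha>1 (i1 s) = s"
    using class_K_inf_inverse[OF a1] by metis
  obtain i2 where i2: "class_K \<infinity> i2" "\<And>s. 0 \<le> s \<Longrightarrow> 0 \<le> i2 s" "\<And>s. 0 \<le> s \<Longrightarrow> \<alpha>2 (i2 s) = s"
    using class_K_inf_inverse[OF a2] by metis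
  obtain i3 where i3: "class_K \<infinity> i3" "\<And>s. 0 \<le> s \<Longrightarrow> 0 \<le> i3 s" "\<And>s. 0 \<le> s \<Longrightarrow> \<alpha>3 (i3 s) = s"
    using class_K_inf_inverse[OF a3] by metis
  have "local_lipschitz {0::real} (cball ze R) (\<lambda>_. V)"
    using V_lipschitz unfolding locally_lipschitz_def by (rule local_lipschitz_subset) auto
  then obtain L0 where L0: "L0-lipschitz_on (cball ze R) V"
    by (rule local_lipschitz_compact_implies_lipschitz) (auto intro: continuous_intros)
  \<comment> \<open>A Lipschitz constant may be zero; a positive one makes \<open>\<gamma>\<close> strictly increasing.\<close>
  define L where "L = L0 + 1"
  have L: "0 < L" "L-lipschitz_on (cball ze R) V"
    using lipschitz_on_nonneg[OF L0] lipschitz_on_le[OF L0, of L] by (auto simp: L_def)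
  define \<psi> where "\<psi> s = \<alpha>3 (i2 (\<alpha>1 s)) / 2" for s
  have "class_K \<infinity> (\<lambda>s. (1/2) * \<alpha>3 (i2 (\<alpha>1 s)))"
    by (intro class_K_scale class_K_comp[OF K(3)] class_K_comp[OF i2(1)] K) simp
  then have "class_K \<infinity> \<psi>" by (simp add: \<psi>_def[abs_def])
  then obtain \<beta> where \<beta>: "class_KL \<beta>" "\<And>s t. 0 \<le> s \<Longrightarrow> 0 \<le> t \<Longrightarrow> 0 \<le> \<beta> s t"
    "\<And>s t x. 0 \<le> s \<Longrightarrow> 0 \<le> t \<Longrightarrow> 0 \<le> x \<Longrightarrow> \<alpha>1 x + t * \<psi> x \<le> \<alpha>2 s \<Longrightarrow> x \<le> \<beta> s t"
    using class_KL_implicit_root[OF a1 _ K(2)] by metis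
  define B where "B u = \<alpha>2 (i3 (2 * (L * u))) + L * u" for u
  have scaled: "class_K \<infinity> (\<lambda>u. L * u)" using class_K_scale[OF class_K_id L(1)] .
  have B: "class_K \<infinity> B"
    unfolding B_def by (intro class_K_add class_K_comp[OF K(2)] class_K_comp[OF i3(1)]
        class_K_scale scaled) simp
  define \<gamma> where "\<gamma> u = i1 (B u)" for u
  have \<gamma>: "class_K \<infinity> \<gamma>" unfolding \<gamma>_def by (rule class_K_comp[OF i1(1) B])
  have \<gamma>_bound: "s \<le> \<gamma> u" if "0 \<le> s" "0 \<le> u" "\<alpha>1 s \<le> B u" for s u
    using that class_K_le_iff[OF K(1), of s "\<gamma> u"] i1 class_K_nonneg[OF B] by (simp add: \<gamma>_def)

  have "w ze = ze" using equilibrium by (simp add: perturbed_def)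
  then obtain \<delta>0 where \<delta>0: "0 < \<delta>0" "\<And>y. dist y ze < \<delta>0 \<Longrightarrow> dist (w y) ze < R / 2"
    using w_cont \<open>0 < R\<close> unfolding continuous_at_eps_delta by (metis half_gt_zero)
  define \<delta> where "\<delta> = min (\<delta>0 / 2) R"
  have \<delta>: "0 < \<delta>" "\<delta> \<le> R" and w_near: "\<And>y. norm (y - ze) \<le> \<delta> \<Longrightarrow> norm (w y - ze) \<le> R / 2"
    using \<delta>0 \<open>0 < R\<close> by (auto simp: \<delta>_def dist_norm intro!: less_imp_le)
  define r where "r = min \<delta> (i2 (\<alpha>1 \<delta>))"
  have \<alpha>1\<delta>: "0 < \<alpha>1 \<delta>" using class_K_pos[OF K(1) \<delta>(1)] .
  have r: "0 < r" "r \<le> \<delta>" "r \<le> i2 (\<alpha>1 \<delta>)"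
    using class_K_pos[OF i2(1) \<alpha>1\<delta>] \<delta> by (auto simp: r_def)
  obtain b' where "0 < b'" "\<And>u. 0 \<le> u \<Longrightarrow> u \<le> b' \<Longrightarrow> B u \<le> \<alpha>1 \<delta>"
  proof -
    have "(B \<longlongrightarrow> 0) (at 0 within {0..})"
      using class_K_cont[OF B] class_K_zero[OF B] by (force simp: continuous_on_def)
    then have "eventually (\<lambda>u. B u < \<alpha>1 \<delta>) (at 0 within {0..})"
      using \<alpha>1\<delta> by (rule order_tendstoD)
    then obtain e where e: "0 < e" "\<And>u. 0 < u \<Longrightarrow> u < e \<Longrightarrow> B u < \<alpha>1 \<delta>"
      by (force simp: eventually_at dist_real_def)
    have "B u \<le> \<alpha>1 \<delta>" if "0 \<le> u" "u \<le> e / 2" for u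
      using e(1) e(2)[of u] class_K_zero[OF B] \<alpha>1\<delta> that by (cases "u = 0") auto
    then show ?thesis using that[of "e / 2"] e(1) by auto
  qed
  define qb where "qb = min b' (R / 2)"
  have qb: "0 < qb" "qb \<le> R / 2" "\<And>u. 0 \<le> u \<Longrightarrow> u \<le> qb \<Longrightarrow> B u \<le> \<alpha>1 \<delta>"
    using \<open>0 < b'\<close> \<open>0 < R\<close> \<open>\<And>u. 0 \<le> u \<Longrightarrow> u \<le> b' \<Longrightarrow> B u \<le> \<alpha>1 \<delta>\<close> by (auto simp: qb_def)

  have bounds: "\<alpha>1 (norm (z - ze)) \<le> V z" "V z \<le> \<alpha>2 (norm (z - ze))" if "norm (z - ze) \<le> R" for z
    using V_bounds that by (auto simp: dist_norm norm_minus_commute)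
  have near: "norm (w z + q - ze) \<le> R"
    and dissipation: "V (w z + q) \<le> V z - \<alpha>3 (norm (z - ze)) + L * norm q"
    if z: "norm (z - ze) \<le> \<delta>" and q: "norm q \<le> qb" for z q
  proof -
    have wz: "norm (w z - ze) \<le> R / 2" using w_near z .
    have "norm (w z + q - ze) \<le> norm (w z - ze) + norm q"
      by (metis add_diff_eq add.commute norm_triangle_ineq)
    then show *: "norm (w z + q - ze) \<le> R" using wz q qb by simp
    have "dist (V (w z + q)) (V (w z)) \<le> L * dist (w z + q) (w z)"
      using wz * \<open>0 < R\<close> by (intro lipschitz_onD[OF L(2)]) (auto simp: dist_norm norm_minus_commute)
    then have "V (w z + q) \<le> V (w z) + L * norm q"
      by (simp add: dist_norm)
    moreover have "V (w z) - V z \<le> - \<alpha>3 (norm (z - ze))"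
      using V_decrease z \<delta>(2) by (auto simp: perturbed_def dist_norm norm_minus_commute)
    ultimately show "V (w z + q) \<le> V z - \<alpha>3 (norm (z - ze)) + L * norm q" by simp
  qed

  have estimate: "norm (z k - ze) \<le> \<beta> (norm (z 0 - ze)) (real k) + \<gamma> (SUP j\<in>{0..k}. norm (q j))"
    if q: "\<And>j. norm (q j) \<le> qb" and z0: "norm (z 0 - ze) \<le> r" and sol: "is_solution w q z"
    for q z and k :: nat
  proof -
    have zSuc: "z (Suc j) = w (z j) + q j" for j
      using sol by (simp add: is_solution_def perturbed_def)
    \<comment> \<open>The sublevel bound is what is preserved by a step; it yields the bound on the state, since
      a step cannot leave the large ball, where \<open>\<alpha>1\<close> bounds \<open>V\<close> from below.\<close>
    have inv: "norm (z j - ze) \<le> \<delta> \<and> V (z j) \<le> \<alpha>1 \<delta>" for j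
    proof (induction j)
      case 0
      have "V (z 0) \<le> \<alpha>2 (norm (z 0 - ze))" using bounds z0 r \<delta> by simp
      also have "\<dots> \<le> \<alpha>2 (i2 (\<alpha>1 \<delta>))" using class_K_le_iff[OF K(2)] i2(2) z0 r \<alpha>1\<delta> by simp
      finally show ?case using i2(3) \<alpha>1\<delta> z0 r by simp
    next
      case (Suc j)
      let ?x = "norm (z j - ze)"
      have "V (z (Suc j)) \<le> V (z j) - \<alpha>3 ?x + L * norm (q j)"
        unfolding zSuc using dissipation Suc q by blast
      moreover have "V (z j) \<le> \<alpha>2 ?x" using bounds Suc \<delta> by simp
      ultimately have "V (z (Suc j)) \<le> V (z j) - \<alpha>3 ?x / 2 \<or> V (z (Suc j)) \<le> B (norm (q j))"
        using decrease_or_bounded[OF K(2,3) i3(2,3), of ?x "L * norm (q j)" "V (z j)"] L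
        by (auto simp: B_def)
      moreover have "0 \<le> \<alpha>3 ?x" "B (norm (q j)) \<le> \<alpha>1 \<delta>" using class_K_nonneg[OF K(3)] qb q by auto
      ultimately have V: "V (z (Suc j)) \<le> \<alpha>1 \<delta>" using Suc by linarith
      have "norm (z (Suc j) - ze) \<le> R" unfolding zSuc using near Suc q by blast
      then have "\<alpha>1 (norm (z (Suc j) - ze)) \<le> \<alpha>1 \<delta>" using bounds V by fastforce
      then show ?case using V class_K_le_iff[OF K(1)] \<delta> by simp
    qed
    define u where "u = (SUP j\<in>{0..k}. norm (q j))"
    have qu: "norm (q j) \<le> u" if "j \<le> k" for j
      unfolding u_def using that by (intro cSUP_upper) auto
    have u0: "0 \<le> u" using qu[of 0] norm_ge_zero[of "q 0"] by linarith
    have "\<alpha>1 (norm (z k - ze)) + real k * (\<alpha>3 (i2 (\<alpha>1 (norm (z k - ze)))) / 2) \<le> \<alpha>2 (norm (z 0 - ze))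
      \<or> \<alpha>1 (norm (z k - ze)) \<le> \<alpha>2 (i3 (2 * (L * u))) + L * u"
    proof (rule transient_or_bounded[OF K i2(2,3) i3(2,3), where v = "\<lambda>j. V (z j)"])
      fix j assume "j < k"
      have "V (z (Suc j)) \<le> V (z j) - \<alpha>3 (norm (z j - ze)) + L * norm (q j)"
        unfolding zSuc using dissipation inv q by blast
      moreover have "L * norm (q j) \<le> L * u" using qu[of j] \<open>j < k\<close> L by simp
      ultimately show "V (z (Suc j)) \<le> V (z j) - \<alpha>3 (norm (z j - ze)) + L * u" by simp
    next
      have R: "norm (z j - ze) \<le> R" for j using inv[of j] \<delta> by simp
      show "\<alpha>1 (norm (z j - ze)) \<le> V (z j)" "V (z j) \<le> \<alpha>2 (norm (z j - ze))" for j
        using bounds[OF R] by auto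
    qed (use L u0 in auto)
    then have "norm (z k - ze) \<le> \<beta> (norm (z 0 - ze)) (real k) \<or> norm (z k - ze) \<le> \<gamma> u"
      using \<beta>(3)[of "norm (z 0 - ze)" "real k" "norm (z k - ze)"] \<gamma>_bound[of "norm (z k - ze)" u] u0
      by (auto simp: \<psi>_def B_def)
    then show ?thesis
      using \<beta>(2)[of "norm (z 0 - ze)" "real k"] class_K_nonneg[OF \<gamma> u0] by (auto simp: u_def)
  qed

  show ?thesis
  proof (rule exI[of _ \<beta>], rule exI[of _ \<gamma>], rule exI[of _ \<infinity>], rule exI[of _ r], rule exI[of _ qb],
      intro conjI allI impI)
    fix q z k
    assume h: "(SUP k. ereal (norm (q k))) \<le> ereal qb \<and> z 0 \<in> cball ze r \<and> is_solution w q z"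
    have "norm (q j) \<le> qb" for j using h by (auto simp: SUP_le_iff)
    then show "norm (z k - ze) \<le> \<beta> (norm (z 0 - ze)) (real k) + \<gamma> (SUP j\<in>{0..k}. norm (q j))"
      using h by (intro estimate) (auto simp: dist_norm norm_minus_commute)
  qed (use \<beta>(1) \<gamma> r qb in auto)
qed

end
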